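(* For even $n\ge4$ the matrix $L_{even}$, and for odd $n\ge5$ the matrix $L_{odd}$ (both defined in the context), have the following properties: (i) it is positive semidefinite; (ii) each of its row sums is $0$; (iii) its rank is $n-1$.
   Context: $\mathbf{1}_p$ is the all-ones vector in $\mathbb{R}^p$, $J_p=\mathbf{1}_p\mathbf{1}_p'$, $I_p$ the identity, $O$ a zero matrix, $X'$ the transpose. $\mathrm{Circ}(a_1,\dots,a_p)$ is the $p\times p$ circulant matrix with first row $(a_1,\dots,a_p)$, each subsequent row being the previous one shifted cyclically one position to the right. Let $\phi_k=\cos(\frac{\pi k}{n-1})$ for $k=1,\dots,n-2$, $C_k=\mathrm{Circ}(1,\cos\frac{2\pi k}{n-1},\dots,\cos\frac{2\pi(n-2)k}{n-1})$, $\widetilde{C_k}=\mathrm{Circ}(\cos\frac{2\pi k}{n-1},\dots,\cos\frac{2\pi(n-2)k}{n-1},1)$ (all of size $n-1$). Define the $(2n-1)\times(2n-1)$ matrices \[A=\frac{9(n-1)}{(n+4)^2}\begin{bmatrix}1&\frac{n-2}{3(n-1)}\mathbf{1}_{n-1}'&\frac{-(n+1)}{3(n-1)}\mathbf{1}_{n-1}'\\ \frac{n-2}{3(n-1)}\mathbf{1}_{n-1}&\frac{(n-2)^2}{9(n-1)^2}J_{n-1}&\frac{-(n-2)(n+1)}{9(n-1)^2}J_{n-1}\\ \frac{-(n+1)}{3(n-1)}\mathbf{1}_{n-1}&\frac{-(n-2)(n+1)}{9(n-1)^2}J_{n-1}&\frac{(n+1)^2}{9(n-1)^2}J_{n-1}\end{bmatrix},\]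 for $k$ with $\phi_k\ne0$ \[B_k=\frac{2}{(n-1)(2\phi_k+\frac{1}{2\phi_k})^2}\begin{bmatrix}0&\mathbf{0}&\mathbf{0}\\ \mathbf{0}&\frac{C_k}{4\phi_k^2}&\frac{C_k+\widetilde{C_k}}{4\phi_k^2}\\ \mathbf{0}&\frac{C_k+\widetilde{C_k}'}{4\phi_k^2}&C_k\end{bmatrix},\] and $H=\frac{1}{n-1}\begin{bmatrix}0&\mathbf{0}'&\mathbf{0}'\\ \mathbf{0}&R&O\\ \mathbf{0}&O&O\end{bmatrix}$ with $R(r,s)=(-1)^{r+s}$ ($R$ of size $n-1$). For even $n\ge4$, $L_{even}=A+\sum_{k=1}^{(n-2)/2}B_k$; for odd $n\ge5$, $L_{odd}=A+H+\sum_{k=1}^{(n-3)/2}B_k$. *)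

theory Defs
  imports Complex_Main "Jordan_Normal_Form.DL_Rank"
begin

definition append_cols :: "'a :: zero mat \<Rightarrow> 'a mat \<Rightarrow> 'a mat" (infixr \<open>@\<^sub>c\<close> 65) where
  "A @\<^sub>c B = four_block_mat A B (0\<^sub>m 0 (dim_col A)) (0\<^sub>m 0 (dim_col B))"

definition nine_block_mat ::
  "'a :: zero mat \<Rightarrow> 'a mat \<Rightarrow> 'a mat \<Rightarrow>
   'a mat \<Rightarrow> 'a mat \<Rightarrow> 'a mat \<Rightarrow>
   'a mat \<Rightarrow> 'a mat \<Rightarrow> 'a mat \<Rightarrow> 'a mat" where
  "nine_block_mat A11 A12 A13
                  A21 A22 A23
                  A31 A32 A33 =
     four_block_mat A11 (A12 @\<^sub>c A13) (A21 @\<^sub>r A31) (four_block_mat A22 A23 A32 A33)"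

definition ones_col :: "nat \<Rightarrow> real mat" where
  "ones_col p = mat p 1 (\<lambda>_. 1)"

definition J_mat :: "nat \<Rightarrow> real mat" where
  "J_mat p = ones_col p * transpose_mat (ones_col p)"

text \<open>The argument is the first row; entry \<open>(i, j)\<close> is the first-row entry at position
  \<open>j - i\<close> modulo \<open>p\<close> (the summand \<open>p\<close> avoids truncated subtraction).\<close>

definition Circ :: "'a list \<Rightarrow> 'a mat" where
  "Circ a = (let p = length a in mat p p (\<lambda>(i, j). a ! ((j + p - i) mod p)))"

definition phi :: "nat \<Rightarrow> nat \<Rightarrow> real" where
  "phi n k = cos (pi * real k / (real n - 1))"

definition cos_list :: "nat \<Rightarrow> nat \<Rightarrow> real list" where
  "cos_list n k = map (\<lambda>j. cos (2 * pi * real j * real k / (real n - 1))) [1..<n - 1]"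

definition C_mat :: "nat \<Rightarrow> nat \<Rightarrow> real mat" where
  "C_mat n k = Circ (1 # cos_list n k)"

definition Ct_mat :: "nat \<Rightarrow> nat \<Rightarrow> real mat" where
  "Ct_mat n k = Circ (cos_list n k @ [1])"

definition A_mat :: "nat \<Rightarrow> real mat" where
  "A_mat n =
    (let m = real n; p = n - 1; u = ones_col p; u' = transpose_mat u; J = J_mat p in
     (9 * (m - 1) / (m + 4)\<^sup>2) \<cdot>\<^sub>m
     nine_block_mat
       (1\<^sub>m 1)
       (((m - 2) / (3 * (m - 1))) \<cdot>\<^sub>m u')
       ((- (m + 1) / (3 * (m - 1))) \<cdot>\<^sub>m u')
       (((m - 2) / (3 * (m - 1))) \<cdot>\<^sub>m u)
       (((m - 2)\<^sup>2 / (9 * (m - 1)\<^sup>2)) \<cdot>\<^sub>m J)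
       ((- (m - 2) * (m + 1) / (9 * (m - 1)\<^sup>2)) \<cdot>\<^sub>m J)
       ((- (m + 1) / (3 * (m - 1))) \<cdot>\<^sub>m u)
       ((- (m - 2) * (m + 1) / (9 * (m - 1)\<^sup>2)) \<cdot>\<^sub>m J)
       (((m + 1)\<^sup>2 / (9 * (m - 1)\<^sup>2)) \<cdot>\<^sub>m J))"

text \<open>Only meaningful for \<open>phi n k \<noteq> 0\<close>, which holds for every \<open>k\<close> in the
  ranges of summation below.\<close>

definition B_mat :: "nat \<Rightarrow> nat \<Rightarrow> real mat" where
  "B_mat n k =
    (let m = real n; p = n - 1; f = phi n k; C = C_mat n k; Ct = Ct_mat n k in
     (2 / ((m - 1) * (2 * f + 1 / (2 * f))\<^sup>2)) \<cdot>\<^sub>m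
     nine_block_mat
       (0\<^sub>m 1 1) (0\<^sub>m 1 p)                                          (0\<^sub>m 1 p)
       (0\<^sub>m p 1) ((1 / (4 * f\<^sup>2)) \<cdot>\<^sub>m C)                          ((1 / (4 * f\<^sup>2)) \<cdot>\<^sub>m (C + Ct))
       (0\<^sub>m p 1) ((1 / (4 * f\<^sup>2)) \<cdot>\<^sub>m (C + transpose_mat Ct))     C)"

text \<open>Indices start at 0 here; \<open>(-1)\<^bsup>r+s\<^esup>\<close> is the same as for indices starting at 1.\<close>

definition R_mat :: "nat \<Rightarrow> real mat" where
  "R_mat p = mat p p (\<lambda>(r, s). (- 1) ^ (r + s))"

definition H_mat :: "nat \<Rightarrow> real mat" where
  "H_mat n =
    (let p = n - 1 in
     (1 / (real n - 1)) \<cdot>\<^sub>m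
     nine_block_mat
       (0\<^sub>m 1 1) (0\<^sub>m 1 p) (0\<^sub>m 1 p)
       (0\<^sub>m p 1) (R_mat p)   (0\<^sub>m p p)
       (0\<^sub>m p 1) (0\<^sub>m p p) (0\<^sub>m p p))"

text \<open>The type of matrices of all dimensions is no additive monoid, so the sum of the matrices
  \<open>B_mat n 1, \<dots>, B_mat n K\<close> is taken entrywise.\<close>

definition B_sum :: "nat \<Rightarrow> nat \<Rightarrow> real mat" where
  "B_sum n K = mat (2 * n - 1) (2 * n - 1) (\<lambda>ij. \<Sum>k = 1..K. B_mat n k $$ ij)"

definition L_even :: "nat \<Rightarrow> real mat" where
  "L_even n = A_mat n + B_sum n ((n - 2) div 2)"

definition L_odd :: "nat \<Rightarrow> real mat" where
  "L_odd n = A_mat n + H_mat n + B_sum n ((n - 3) div 2)"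

definition positive_semidefinite :: "real mat \<Rightarrow> bool" where
  "positive_semidefinite M \<longleftrightarrow>
     square_mat M \<and> transpose_mat M = M \<and>
     (\<forall>x \<in> carrier_vec (dim_row M). 0 \<le> x \<bullet> (M *\<^sub>v x))"

definition row_sum :: "real mat \<Rightarrow> nat \<Rightarrow> real" where
  "row_sum M i = (\<Sum>j < dim_col M. M $$ (i, j))"

lemma dim_nine_block_mat [simp]:
  "dim_row (nine_block_mat A11 A12 A13 A21 A22 A23 A31 A32 A33) =
     dim_row A11 + (dim_row A22 + dim_row A33)"
  "dim_col (nine_block_mat A11 A12 A13 A21 A22 A23 A31 A32 A33) =
     dim_col A11 + (dim_col A22 + dim_col A33)"
  by (simp_all add: nine_block_mat_def)

lemma dim_C_mat:
  assumes "2 \<le> n"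
  shows "dim_row (C_mat n k) = n - 1" and "dim_col (C_mat n k) = n - 1"
  using assms by (simp_all add: C_mat_def Circ_def Let_def cos_list_def)

lemma carrier_L:
  assumes "2 \<le> n"
  shows "A_mat n \<in> carrier_mat (2 * n - 1) (2 * n - 1)"
    and "B_mat n k \<in> carrier_mat (2 * n - 1) (2 * n - 1)"
    and "H_mat n \<in> carrier_mat (2 * n - 1) (2 * n - 1)"
    and "L_even n \<in> carrier_mat (2 * n - 1) (2 * n - 1)"
    and "L_odd n \<in> carrier_mat (2 * n - 1) (2 * n - 1)"
proof -
  show "A_mat n \<in> carrier_mat (2 * n - 1) (2 * n - 1)"
    using assms by (intro carrier_matI) (simp_all add: A_mat_def Let_def J_mat_def ones_col_def)
  show "B_mat n k \<in> carrier_mat (2 * n - 1) (2 * n - 1)"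
    using assms by (intro carrier_matI) (simp_all add: B_mat_def Let_def dim_C_mat)
  show "H_mat n \<in> carrier_mat (2 * n - 1) (2 * n - 1)"
    using assms by (intro carrier_matI) (simp_all add: H_mat_def Let_def R_mat_def)
  show "L_even n \<in> carrier_mat (2 * n - 1) (2 * n - 1)"
    by (intro carrier_matI) (simp_all add: L_even_def B_sum_def)
  show "L_odd n \<in> carrier_mat (2 * n - 1) (2 * n - 1)"
    by (intro carrier_matI) (simp_all add: L_odd_def B_sum_def)
qed

end

theory Submission
  imports Defs
begin

text \<open>
  Put \<open>p = n - 1\<close>. Since \<open>cos x + cos (x + \<theta>) = 2 cos (\<theta>/2) cos (x + \<theta>/2)\<close>, the
  matrix \<open>B_mat n k\<close> is a positive multiple of \<open>u u' + v v'\<close>, where \<open>u\<close> and \<open>v\<close> sample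
  the cosine and the sine of frequency \<open>2 \<pi> k / p\<close>, at the integers in the middle block (scaled by
  \<open>1 / (2 phi n k)\<close>) and at the half-integers in the last block. Likewise \<open>A_mat n\<close> has rank one,
  and so has \<open>H_mat n\<close>, which is the frequency \<open>k = p / 2\<close>. Thus both matrices \<open>L\<close> are sums
  of \<open>p\<close> positive multiples of \<open>w w'\<close> with pairwise orthogonal nonzero vectors \<open>w\<close> whose entries
  sum to zero, so these \<open>w\<close> form a basis of the column space.
\<close>

section \<open>Weighted sums of rank-one matrices: rank, semidefiniteness, row sums\<close>

definition rank_one_sum :: "nat \<Rightarrow> nat \<Rightarrow> (nat \<Rightarrow> 'a) \<Rightarrow> (nat \<Rightarrow> 'a vec) \<Rightarrow> 'a :: comm_semiring_0 mat" where
  "rank_one_sum N m c w = mat N N (\<lambda>(i, j). \<Sum>t<m. c t * w t $ i * w t $ j)"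

text \<open>The family \<open>v\<close> is indexed and may repeat vectors, as the columns of a
  matrix may; so the sum is not written as a \<open>lincomb\<close> over a set.\<close>

lemma (in vec_space) weighted_sum_in_span:
  fixes m :: nat
  assumes S: "S \<subseteq> carrier_vec n" and v: "\<And>t. t < m \<Longrightarrow> v t \<in> span S"
  shows "vec n (\<lambda>i. \<Sum>t<m. b t * v t $ i) \<in> span S"
  using v
proof (induction m)
  case 0
  have "vec n (\<lambda>i. \<Sum>t<0. b t * v t $ i) = 0\<^sub>v n" by (intro eq_vecI) auto
  moreover have "0\<^sub>v n \<in> span S"
    using span_is_monotone[of "{}" S] by (simp add: span_empty)
  ultimately show ?case by simp
next
  case (Suc m)
  have vm: "v m \<in> carrier_vec n" using Suc.prems[of m] span_closed[OF S] by auto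
  have "vec n (\<lambda>i. \<Sum>t<Suc m. b t * v t $ i) = vec n (\<lambda>i. \<Sum>t<m. b t * v t $ i) + b m \<cdot>\<^sub>v v m"
    using vm by (intro eq_vecI) auto
  then show ?case using Suc span_add1[OF S] smult_in_span[OF S] by simp
qed

text \<open>Pairing a vanishing combination with \<open>v\<close> leaves only
  \<open>a v * (v \<bullet> v)\<close>. Over an arbitrary field a nonzero vector may be orthogonal
  to itself, hence the hypothesis \<open>nz\<close>.\<close>

lemma (in vec_space) orthogonal_lin_indpt:
  assumes fin: "finite S" and S: "S \<subseteq> carrier_vec n"
    and orth: "\<And>u v. u \<in> S \<Longrightarrow> v \<in> S \<Longrightarrow> u \<noteq> v \<Longrightarrow> u \<bullet> v = 0"
    and nz: "\<And>v. v \<in> S \<Longrightarrow> v \<bullet> v \<noteq> 0"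
  shows "lin_indpt S"
proof (rule finite_lin_indpt2[OF fin])
  show "S \<subseteq> carrier_vec n" by (rule S)
  fix a assume 0: "lincomb a S = 0\<^sub>v n"
  show "\<forall>v\<in>S. a v = 0"
  proof
    fix v assume v: "v \<in> S"
    have vd: "dim_vec u = n" if "u \<in> S" for u using that S by auto
    have "0 = (\<Sum>i<n. v $ i * lincomb a S $ i)" by (simp add: 0)
    also have "\<dots> = (\<Sum>i<n. v $ i * (\<Sum>u\<in>S. a u * u $ i))"
      by (intro sum.cong refl) (simp add: lincomb_index[OF _ S])
    also have "\<dots> = (\<Sum>u\<in>S. a u * (v \<bullet> u))"
      by (simp add: sum_distrib_left scalar_prod_def vd atLeast0LessThan)
        (subst sum.swap, simp add: vd mult_ac)
    also have "\<dots> = (\<Sum>u\<in>S. if u = v then a v * (v \<bullet> v) else 0)"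
      by (intro sum.cong refl) (use orth v in auto)
    also have "\<dots> = a v * (v \<bullet> v)" using fin v by simp
    finally show "a v = 0" using nz[OF v] by simp
  qed
qed

text \<open>The columns and the vectors \<open>w t\<close> span each other: each column is visibly a
  combination of the \<open>w t\<close>, and by orthogonality each \<open>w s\<close> is an
  eigenvector for a nonzero eigenvalue, hence in the column space. Being distinct and independent,
  the \<open>w t\<close> are a basis of it.\<close>

lemma (in vec_space) rank_orthogonal_rank_one_sum:
  assumes w: "\<And>t. t < m \<Longrightarrow> w t \<in> carrier_vec n"
    and orth: "\<And>s t. s < m \<Longrightarrow> t < m \<Longrightarrow> s \<noteq> t \<Longrightarrow> w s \<bullet> w t = 0"
    and nz: "\<And>t. t < m \<Longrightarrow> w t \<bullet> w t \<noteq> 0"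
    and c: "\<And>t. t < m \<Longrightarrow> c t \<noteq> 0"
  shows "rank (rank_one_sum n m c w) = m"
proof -
  let ?M = "rank_one_sum n m c w" and ?S = "w ` {..<m}"
  have S: "?S \<subseteq> carrier_vec n" using w by auto
  have dims: "dim_row ?M = n" "dim_col ?M = n" by (simp_all add: rank_one_sum_def)
  have C: "set (cols ?M) \<subseteq> carrier_vec n" using cols_dim[of ?M] dims by simp
  \<comment> \<open>If \<open>w s = w t\<close> with \<open>s \<noteq> t\<close>, then
    \<open>orth\<close> would make \<open>w t\<close> orthogonal to itself, against
    \<open>nz\<close>.\<close>
  have inj: "inj_on w {..<m}"
    by (rule inj_onI) (metis lessThan_iff nz orth)
  have indpt: "lin_indpt ?S"
    by (rule orthogonal_lin_indpt[OF _ S]) (use orth nz in auto)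
  have "col ?M j \<in> span ?S" if "j < n" for j
  proof -
    have "col ?M j = vec n (\<lambda>i. \<Sum>t<m. (c t * w t $ j) * w t $ i)"
      using that by (intro eq_vecI) (simp_all add: rank_one_sum_def mult_ac)
    then show ?thesis
      using weighted_sum_in_span[OF S, of m w "\<lambda>t. c t * w t $ j"] in_own_span[OF S] by auto
  qed
  then have CS: "set (cols ?M) \<subseteq> span ?S" by (auto simp: cols_def dims)
  have "w s \<in> span (set (cols ?M))" if s: "s < m" for s
  proof -
    \<comment> \<open>The eigenvalue of \<open>?M\<close> at \<open>w s\<close>; dividing
      \<open>?M *\<^sub>v w s\<close> by it recovers \<open>w s\<close> as a combination of
      columns.\<close>
    let ?q = "c s * (w s \<bullet> w s)"
    have wd: "dim_vec (w t) = n" if "t < m" for t using w[OF that] by auto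
    have q: "?q \<noteq> 0" using c nz s by simp
    have "w s = vec n (\<lambda>i. \<Sum>j<n. (w s $ j / ?q) * col ?M j $ i)"
    proof (intro eq_vecI, simp_all add: wd[OF s])
      fix i assume i: "i < n"
      have "(\<Sum>j<n. w s $ j * col ?M j $ i) = (\<Sum>t<m. (c t * w t $ i) * (w t \<bullet> w s))"
        using i by (simp add: rank_one_sum_def sum_distrib_left scalar_prod_def wd[OF s]
            atLeast0LessThan mult_ac) (rule sum.swap)
      also have "\<dots> = (\<Sum>t<m. if t = s then ?q * w s $ i else 0)"
        by (intro sum.cong refl) (use orth s in auto)
      also have "\<dots> = ?q * w s $ i" using s by simp
      finally have "(\<Sum>j<n. w s $ j * col ?M j $ i) / ?q = w s $ i" using q by simp
      then show "w s $ i = (\<Sum>j<n. w s $ j * col ?M j $ i / ?q)"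
        by (simp only: sum_divide_distrib)
    qed
    moreover have "col ?M j \<in> span (set (cols ?M))" if "j < n" for j
      using in_own_span[OF C] that dims by (auto simp: cols_def)
    ultimately show ?thesis
      using weighted_sum_in_span[OF C, of n "col ?M" "\<lambda>j. w s $ j / ?q"] by simp
  qed
  then have "?S \<subseteq> span (set (cols ?M))" by auto
  then have "span (set (cols ?M)) = span ?S"
    using CS C S by (intro subset_antisym span_subsetI)
  then have "rank ?M = vectorspace.dim class_ring (span_vs ?S)" by (simp add: rank_def)
  also have "\<dots> = card ?S"
    using S indpt by (intro dim_span) (auto simp: maximal_def)
  also have "\<dots> = m" using card_image[OF inj] by simp
  finally show ?thesis .
qed

text \<open>The quadratic form at \<open>x\<close> is the sum of the squares of
  \<open>w t \<bullet> x\<close>, weighted by \<open>c t\<close>.\<close>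

lemma positive_semidefinite_rank_one_sum:
  fixes w :: "nat \<Rightarrow> real vec"
  assumes c: "\<And>t. t < m \<Longrightarrow> 0 \<le> c t"
  shows "positive_semidefinite (rank_one_sum N m c w)"
  unfolding positive_semidefinite_def
proof (intro conjI ballI)
  let ?M = "rank_one_sum N m c w"
  have dims: "dim_row ?M = N" "dim_col ?M = N" by (simp_all add: rank_one_sum_def)
  then show "square_mat ?M" by simp
  show "transpose_mat ?M = ?M"
    by (rule eq_matI) (auto simp: rank_one_sum_def mult_ac)
  fix x :: "real vec" assume "x \<in> carrier_vec (dim_row ?M)"
  then have x: "dim_vec x = N" using dims by auto
  have "x \<bullet> (?M *\<^sub>v x) = (\<Sum>i<N. \<Sum>j<N. \<Sum>t<m. c t * ((w t $ i * x $ i) * (w t $ j * x $ j)))"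
    by (simp add: scalar_prod_def x rank_one_sum_def atLeast0LessThan sum_distrib_left
        sum_distrib_right mult_ac)
  also have "\<dots> = (\<Sum>i<N. \<Sum>t<m. \<Sum>j<N. c t * ((w t $ i * x $ i) * (w t $ j * x $ j)))"
    by (rule sum.cong[OF refl sum.swap])
  also have "\<dots> = (\<Sum>t<m. \<Sum>i<N. \<Sum>j<N. c t * ((w t $ i * x $ i) * (w t $ j * x $ j)))"
    by (rule sum.swap)
  also have "\<dots> = (\<Sum>t<m. c t * (\<Sum>i<N. w t $ i * x $ i)\<^sup>2)"
    by (simp only: power2_eq_square sum_product) (simp only: sum_distrib_left)
  also have "\<dots> \<ge> 0" using c by (intro sum_nonneg) simp
  finally show "0 \<le> x \<bullet> (?M *\<^sub>v x)" .
qed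

lemma row_sum_rank_one_sum:
  assumes "i < N" and "\<And>t. t < m \<Longrightarrow> (\<Sum>j<N. w t $ j) = 0"
  shows "row_sum (rank_one_sum N m c w) i = 0"
proof -
  have "row_sum (rank_one_sum N m c w) i = (\<Sum>j<N. \<Sum>t<m. c t * w t $ i * w t $ j)"
    using assms(1) by (simp add: row_sum_def rank_one_sum_def)
  also have "\<dots> = (\<Sum>t<m. \<Sum>j<N. c t * w t $ i * w t $ j)"
    by (rule sum.swap)
  also have "\<dots> = 0" using assms(2) by (simp flip: sum_distrib_left)
  finally show ?thesis .
qed

section \<open>Sums of cosines over equally spaced angles\<close>

text \<open>Multiplied by \<open>2 * sin h\<close>, where \<open>h\<close> is half the step of the
  angle, the sum telescopes. The two end angles differ by \<open>q\<close> full turns, and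
  \<open>sin h\<close> is nonzero because \<open>p\<close> does not divide \<open>q\<close>.\<close>

lemma sum_cos_arithmetic_progression_eq_0:
  fixes q :: int
  assumes "\<not> int p dvd q"
  shows "(\<Sum>i<p. cos (2 * pi * real_of_int q * real i / real p + \<gamma>)) = 0"
proof (cases "p = 0")
  case False
  define h where "h = pi * q / p"
  have "2 * sin h * cos (2 * h * real i + \<gamma>) =
      sin (2 * h * real (Suc i) - h + \<gamma>) - sin (2 * h * real i - h + \<gamma>)" for i
  proof -
    have "2 * h * real (Suc i) - h + \<gamma> = (2 * h * real i + \<gamma>) + h"
      "2 * h * real i - h + \<gamma> = (2 * h * real i + \<gamma>) - h"
      by (simp_all add: algebra_simps)
    then show ?thesis by (simp only: sin_add sin_diff) simp
  qed
  then have "2 * sin h * (\<Sum>i<p. cos (2 * h * real i + \<gamma>)) =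
      sin (2 * h * real p - h + \<gamma>) - sin (2 * h * real 0 - h + \<gamma>)"
    by (simp only: sum_distrib_left
        sum_lessThan_telescope[of "\<lambda>i. sin (2 * h * real i - h + \<gamma>)"])
  also have "2 * h * real p - h + \<gamma> = (- h + \<gamma>) + (2 * pi) * of_int q"
    using False by (simp add: h_def field_simps)
  also have "sin \<dots> - sin (2 * h * real 0 - h + \<gamma>) = 0"
    by (simp only: sin_add sin_int_2pin cos_int_2pin) simp
  finally have "sin h = 0 \<or> (\<Sum>i<p. cos (2 * h * real i + \<gamma>)) = 0" by simp
  moreover have "sin h \<noteq> 0"
  proof
    assume "sin h = 0"
    then obtain z :: int where "pi * q / p = z * pi"
      by (auto simp: sin_zero_iff_int2 h_def)
    then have "real_of_int q = real_of_int (int p * z)" using False by (simp add: field_simps)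
    then show False using assms by (metis dvd_triv_left of_int_eq_iff)
  qed
  ultimately show ?thesis by (simp add: h_def mult_ac)
qed simp

text \<open>The shift \<open>s\<close> will be 0 or 1/2 according to the block, and \<open>d\<close>
  will be 0 or \<open>pi / 2\<close> for cosine or sine; both are absorbed into the phase.\<close>

lemma sum_cos_shifted_eq_0:
  assumes "0 < k" "k < p"
  shows "(\<Sum>i<p. cos (2 * pi * real k * (real i + s) / real p - d)) = 0"
proof -
  have "\<not> int p dvd int k" using assms by (auto dest: zdvd_imp_le)
  from sum_cos_arithmetic_progression_eq_0[OF this, of "2 * pi * real k * s / real p - d"]
  show ?thesis by (simp add: ring_distribs add_divide_distrib add_diff_eq)
qed

text \<open>The product formula yields the frequencies \<open>k + l\<close> and
  \<open>k - l\<close>, neither of them divisible by \<open>p\<close> if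
  \<open>k \<noteq> l\<close>. For \<open>k = l\<close> the difference terms are all equal to the
  constant \<open>cos (e - d)\<close>, which is 0.\<close>

lemma sum_cos_mult_cos_eq_0:
  assumes "0 < k" "0 < l" "k + l < p" and kl: "k \<noteq> l \<or> cos (d - e) = 0"
  shows "(\<Sum>i<p. cos (2 * pi * real k * (real i + s) / real p - d) *
                 cos (2 * pi * real l * (real i + s) / real p - e)) = 0"
proof -
  have p: "0 < real p" using assms by simp
  have "\<not> int p dvd int k + int l" using assms by (auto dest!: zdvd_imp_le)
  from sum_cos_arithmetic_progression_eq_0[OF this, of "2 * pi * real (k + l) * s / real p - (d + e)"]
  have plus: "(\<Sum>i<p. cos ((2 * pi * real k * (real i + s) / real p - d) +
                 (2 * pi * real l * (real i + s) / real p - e))) = 0"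
    (is "sum ?f _ = 0")
  proof (rule trans[rotated], intro sum.cong refl)
    show "?f i = cos (2 * pi * real_of_int (int k + int l) * real i / real p +
        (2 * pi * real (k + l) * s / real p - (d + e)))" for i
      using p by (intro arg_cong[of _ _ cos]) (simp add: field_simps)
  qed
  have minus: "(\<Sum>i<p. cos ((2 * pi * real k * (real i + s) / real p - d) -
                 (2 * pi * real l * (real i + s) / real p - e))) = 0" (is "sum ?f _ = 0")
  proof (cases "k = l")
    case True
    then have "cos (d - e) = 0" using kl by simp
    then have "cos (e - d) = 0" by (metis cos_minus minus_diff_eq)
    then show ?thesis using True by simp
  next
    case False
    have "\<bar>int k - int l\<bar> < int p" "int k - int l \<noteq> 0" using assms False by auto
    then have "\<not> int p dvd int k - int l" by (metis dvd_imp_le_int linorder_not_le abs_of_nat)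
    from sum_cos_arithmetic_progression_eq_0[OF this, of "2 * pi * (real k - real l) * s / real p - (d - e)"]
    show ?thesis
    proof (rule trans[rotated], intro sum.cong refl)
      show "?f i = cos (2 * pi * real_of_int (int k - int l) * real i / real p +
          (2 * pi * (real k - real l) * s / real p - (d - e)))" for i
        using p by (intro arg_cong[of _ _ cos]) (simp add: field_simps)
    qed
  qed
  show ?thesis
    unfolding cos_times_cos using plus minus
    by (simp flip: sum_divide_distrib add: sum.distrib)
qed

text \<open>Removes the \<open>mod\<close> that \<open>Circ\<close> puts on its index.\<close>

lemma cos_mod_period:
  assumes "0 < p"
  shows "cos (2 * pi * real (l mod p) * real k / real p + x) =
    cos (2 * pi * real l * real k / real p + x)"
proof -
  have "real l = real p * real (l div p) + real (l mod p)"
    by (metis mult_div_mod_eq of_nat_add of_nat_mult)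
  then have "2 * pi * real l * real k / real p + x =
      (2 * pi * real (l mod p) * real k / real p + x) + (2 * pi) * real_of_int (int (l div p * k))"
    using assms by (simp add: field_simps)
  \<comment> \<open>This instance of \<open>cos_add\<close> splits off only the full turns and
    leaves the inner sum with \<open>x\<close> alone.\<close>
  then show ?thesis by (simp only: cos_add[of "_ + x"] cos_int_2pin sin_int_2pin)
qed

section \<open>Index blocks of sizes 1, p and p\<close>

lemma index_block_cases:
  assumes "a < 2 * p + 1"
  obtains "a = 0" | i where "i < p" "a = Suc i" | i where "i < p" "a = Suc (p + i)"
proof (cases a)
  case (Suc i)
  show ?thesis
  proof (cases "i < p")
    case False
    then show ?thesis using that(3)[of "i - p"] assms Suc by simp
  qed (use Suc that(2) in auto)
qed (use that(1) in auto)

lemma nine_block_mat_index: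
  assumes "A11 \<in> carrier_mat 1 1" "A12 \<in> carrier_mat 1 p" "A13 \<in> carrier_mat 1 p"
    "A21 \<in> carrier_mat p 1" "A22 \<in> carrier_mat p p" "A23 \<in> carrier_mat p p"
    "A31 \<in> carrier_mat p 1" "A32 \<in> carrier_mat p p" "A33 \<in> carrier_mat p p"
    and "i < p" "j < p"
  defines "M \<equiv> nine_block_mat A11 A12 A13 A21 A22 A23 A31 A32 A33"
  shows "M $$ (0, 0) = A11 $$ (0, 0)" "M $$ (0, Suc j) = A12 $$ (0, j)"
    "M $$ (0, Suc (p + j)) = A13 $$ (0, j)" "M $$ (Suc i, 0) = A21 $$ (i, 0)"
    "M $$ (Suc i, Suc j) = A22 $$ (i, j)" "M $$ (Suc i, Suc (p + j)) = A23 $$ (i, j)"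
    "M $$ (Suc (p + i), 0) = A31 $$ (i, 0)" "M $$ (Suc (p + i), Suc j) = A32 $$ (i, j)"
    "M $$ (Suc (p + i), Suc (p + j)) = A33 $$ (i, j)"
  using assms by (auto simp: nine_block_mat_def append_cols_def append_rows_def)

definition block_vec :: "nat \<Rightarrow> real \<Rightarrow> (nat \<Rightarrow> real) \<Rightarrow> (nat \<Rightarrow> real) \<Rightarrow> real vec" where
  "block_vec p z f g =
     vec (2 * p + 1) (\<lambda>i. if i = 0 then z else if i \<le> p then f (i - 1) else g (i - 1 - p))"

lemma dim_block_vec [simp]: "dim_vec (block_vec p z f g) = 2 * p + 1"
  by (simp add: block_vec_def)

lemma block_vec_index [simp]:
  "block_vec p z f g $ 0 = z"
  "i < p \<Longrightarrow> block_vec p z f g $ Suc i = f i"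
  "i < p \<Longrightarrow> block_vec p z f g $ Suc (p + i) = g i"
  by (auto simp: block_vec_def)

lemma sum_lessThan_blocks:
  fixes F :: "nat \<Rightarrow> 'a :: comm_monoid_add"
  shows "(\<Sum>i<2 * p + 1. F i) = F 0 + ((\<Sum>i<p. F (Suc i)) + (\<Sum>i<p. F (Suc (p + i))))"
proof -
  have "(\<Sum>i<p + q. G i) = (\<Sum>i<p. G i) + (\<Sum>i<q. G (p + i))" for q and G :: "nat \<Rightarrow> 'a"
    by (induction q) (simp_all add: add.assoc)
  from this[where q = p and G = "\<lambda>i. F (Suc i)"] show ?thesis
    by (simp only: Suc_eq_plus1[symmetric] sum.lessThan_Suc_shift mult_2)
qed

lemma sum_block_vec:
  "(\<Sum>i<2 * p + 1. block_vec p z f g $ i) = z + ((\<Sum>i<p. f i) + (\<Sum>i<p. g i))"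
  unfolding sum_lessThan_blocks by simp

lemma scalar_prod_block_vec:
  "block_vec p z f g \<bullet> block_vec p z' f' g' =
     z * z' + ((\<Sum>i<p. f i * f' i) + (\<Sum>i<p. g i * g' i))"
  unfolding scalar_prod_def dim_block_vec atLeast0LessThan sum_lessThan_blocks by simp

section \<open>The orthogonal vectors and their weights\<close>

text \<open>The frequency \<open>2 * k = n - 1\<close>, which occurs only for odd \<open>n\<close>, carries \<open>H_mat n\<close>:
  there \<open>phi n k = 0\<close>, and the wave lives on the middle block alone.\<close>

definition rim_amp :: "nat \<Rightarrow> nat \<Rightarrow> real" where
  "rim_amp n k = (if 2 * k < n - 1 then 1 / (2 * phi n k) else 1)"

definition pendant_amp :: "nat \<Rightarrow> nat \<Rightarrow> real" where
  "pendant_amp n k = (if 2 * k < n - 1 then 1 else 0)"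

text \<open>The summand 0 gives both blocks the shape \<open>real i + s\<close> of the trigonometric
  lemmas, so that these rewrite under \<open>simp only\<close>.\<close>

definition wave_vec :: "nat \<Rightarrow> nat \<Rightarrow> real \<Rightarrow> real vec" where
  "wave_vec n k d = block_vec (n - 1) 0
     (\<lambda>i. rim_amp n k * cos (2 * pi * real k * (real i + 0) / real (n - 1) - d))
     (\<lambda>i. pendant_amp n k * cos (2 * pi * real k * (real i + 1 / 2) / real (n - 1) - d))"

text \<open>The indices \<open>2 * k - 1\<close> and \<open>2 * k\<close> give the cosine and the sine wave of frequency
  \<open>k\<close>; the phase \<open>pi / 2\<close> turns the cosine into a sine.\<close>

definition eigvec :: "nat \<Rightarrow> nat \<Rightarrow> real vec" where
  "eigvec n t =
     (if t = 0 then block_vec (n - 1) 1 (\<lambda>_. (real n - 2) / (3 * (real n - 1)))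
                                        (\<lambda>_. - (real n + 1) / (3 * (real n - 1)))
      else wave_vec n ((t + 1) div 2) (if odd t then 0 else pi / 2))"

text \<open>These are the scalar factors of \<open>A_mat\<close>, \<open>B_mat\<close> and
  \<open>H_mat\<close>. As the vectors \<open>eigvec n t\<close> are not normalised, the actual
  eigenvalue is \<open>eigval n t\<close> times the squared norm of
  \<open>eigvec n t\<close>.\<close>

definition eigval :: "nat \<Rightarrow> nat \<Rightarrow> real" where
  "eigval n t =
     (if t = 0 then 9 * (real n - 1) / (real n + 4)\<^sup>2
      else let f = phi n ((t + 1) div 2) in
        if 2 * ((t + 1) div 2) < n - 1 then 2 / ((real n - 1) * (2 * f + 1 / (2 * f))\<^sup>2)
        else 1 / (real n - 1))"

text \<open>The angle lies between 0 and \<open>pi / 2\<close>. Hence the reciprocal in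
  \<open>rim_amp\<close> and \<open>eigval\<close> is a genuine one and not the default value of
  division by 0.\<close>

lemma phi_pos:
  assumes "2 * k < n - 1"
  shows "0 < phi n k"
  unfolding phi_def
proof (rule cos_gt_zero_pi)
  have n: "real n - 1 > 0" and "2 * real k < real n - 1" using assms by linarith+
  then have "pi * (2 * real k) < pi * (real n - 1)" by simp
  then show "pi * real k / (real n - 1) < pi / 2" using n by (simp add: field_simps)
  have "0 \<le> pi * real k / (real n - 1)" using n by simp
  then show "- (pi / 2) < pi * real k / (real n - 1)" using pi_gt_zero by linarith
qed

lemma eigval_pos:
  assumes "2 \<le> n"
  shows "0 < eigval n t"
proof -
  have "0 < 2 * phi n k + 1 / (2 * phi n k)" if "2 * k < n - 1" for k
    using phi_pos[OF that] by (intro add_pos_pos) auto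
  then have "0 < (real n - 1) * (2 * phi n k + 1 / (2 * phi n k))\<^sup>2" if "2 * k < n - 1" for k
    using that assms by (intro mult_pos_pos zero_less_power) auto
  then show ?thesis using assms by (simp add: eigval_def Let_def)
qed

lemma dim_eigvec: "2 \<le> n \<Longrightarrow> dim_vec (eigvec n t) = 2 * n - 1"
  by (auto simp: eigvec_def wave_vec_def)

text \<open>With \<open>z = 1\<close> this gives the zero entry sum of a wave; with \<open>z\<close>
  the constant entry of \<open>eigvec n 0\<close> on a block it gives orthogonality to
  \<open>eigvec n 0\<close>.\<close>

lemma sum_wave_vec:
  assumes "0 < k" "k < n - 1"
  shows "(\<Sum>i<n - 1. (z::real) * (rim_amp n k * cos (2 * pi * real k * (real i + s) / real (n - 1) - d))) = 0"
    "(\<Sum>i<n - 1. (z::real) * (pendant_amp n k * cos (2 * pi * real k * (real i + s) / real (n - 1) - d))) = 0"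
  using sum_cos_shifted_eq_0[OF assms] by (simp_all flip: sum_distrib_left)

lemma sum_eigvec:
  assumes "3 \<le> n" "t < n - 1"
  shows "(\<Sum>i<2 * n - 1. eigvec n t $ i) = 0"
proof -
  have dim: "2 * n - 1 = 2 * (n - 1) + 1" using assms by simp
  show ?thesis
  proof (cases "t = 0")
    case True
    \<comment> \<open>The entry sum is \<open>1 + (n - 2) / 3 - (n + 1) / 3\<close>.\<close>
    have "real (n - 1) = real n - 1" "real n - 1 \<noteq> 0" using assms by auto
    then show ?thesis
      unfolding dim eigvec_def by (simp only: True refl if_True sum_block_vec) (simp add: field_simps)
  next
    case False
    define k where "k = (t + 1) div 2"
    have k: "0 < k" "k < n - 1" using assms False by (auto simp: k_def)
    have "eigvec n t = wave_vec n k (if odd t then 0 else pi / 2)"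
      using False by (simp add: eigvec_def k_def)
    then show ?thesis
      unfolding dim wave_vec_def using sum_wave_vec[OF k, of 1]
      by (simp only: sum_block_vec mult_1 add_0_left)
  qed
qed

lemma eigvec_orthogonal_less:
  assumes st: "s < t" and tn: "t < n - 1"
  shows "eigvec n s \<bullet> eigvec n t = 0"
proof -
  define l where "l = (t + 1) div 2"
  define e where "e = (if odd t then 0 else pi / 2)"
  have l: "0 < l" "l < n - 1" using st tn by (auto simp: l_def)
  have t: "eigvec n t = wave_vec n l e" using st by (simp add: eigvec_def l_def e_def)
  show ?thesis
  proof (cases "s = 0")
    case True
    show ?thesis unfolding t wave_vec_def eigvec_def[of n s]
      by (simp only: True refl if_True scalar_prod_block_vec sum_wave_vec[OF l] mult_zero_right add_0_left)
  next
    case False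
    define k where "k = (s + 1) div 2"
    define d where "d = (if odd s then 0 else pi / 2)"
    have s: "eigvec n s = wave_vec n k d" using False by (simp add: eigvec_def k_def d_def)
    have k: "0 < k" using False by (auto simp: k_def)
    \<comment> \<open>Since \<open>s < t\<close>, \<open>k\<close> is at most
      \<open>t div 2\<close>, and \<open>t div 2 + (t + 1) div 2 = t\<close>.\<close>
    have kl: "k + l < n - 1" using st tn unfolding k_def l_def by linarith
    \<comment> \<open>Two different indices of equal frequency are a cosine and a sine, whose phases
      differ by \<open>pi / 2\<close>.\<close>
    have "k \<noteq> l \<or> odd s \<noteq> odd t" using st unfolding k_def l_def by presburger
    then have "k \<noteq> l \<or> cos (d - e) = 0" by (auto simp: d_def e_def)
    note orth = sum_cos_mult_cos_eq_0[OF k l(1) kl this]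
    \<comment> \<open>The waves are orthogonal on each block separately, whatever the amplitudes
      \<open>x\<close> and \<open>y\<close>. Here \<open>s\<close> is the real shift, no longer the
      index.\<close>
    have "(\<Sum>i<n - 1. (x * cos (2 * pi * real k * (real i + s) / real (n - 1) - d)) *
           (y * cos (2 * pi * real l * (real i + s) / real (n - 1) - e))) = 0" for x y s :: real
      unfolding mult.assoc[of x] mult.left_commute[of _ y] sum_distrib_left[symmetric] orth
      by simp
    then show ?thesis
      unfolding s t wave_vec_def by (simp only: scalar_prod_block_vec mult_zero_left add_0_left)
  qed
qed

lemma eigvec_orthogonal:
  assumes "2 \<le> n" "s < n - 1" "t < n - 1" "s \<noteq> t"
  shows "eigvec n s \<bullet> eigvec n t = 0"
proof -
  have "eigvec n s \<bullet> eigvec n t = eigvec n t \<bullet> eigvec n s"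
    using assms(1) by (intro comm_scalar_prod[of _ "2 * n - 1"] carrier_vecI dim_eigvec)
  then show ?thesis
    using eigvec_orthogonal_less[of s t n] eigvec_orthogonal_less[of t s n] assms by linarith
qed

text \<open>One nonzero entry suffices: the first one for \<open>t = 0\<close>, the start of the
  middle block for a cosine, and the place after it for a sine, which vanishes at the start.\<close>

lemma eigvec_nonzero:
  assumes n: "3 \<le> n" and t: "t < n - 1"
  shows "eigvec n t \<bullet> eigvec n t \<noteq> 0"
proof -
  define k where "k = (t + 1) div 2"
  have rim: "rim_amp n k \<noteq> 0" using phi_pos[of k n] by (auto simp: rim_amp_def)
  consider "t = 0" | "odd t" | "t \<noteq> 0" "even t" by auto
  then have "\<exists>i<2 * n - 1. eigvec n t $ i \<noteq> 0"
  proof cases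
    case 1
    then show ?thesis using n by (intro exI[of _ 0]) (simp add: eigvec_def)
  next
    case 2
    then have "t \<noteq> 0" using odd_pos by blast
    then show ?thesis using n rim 2
      by (intro exI[of _ "Suc 0"]) (simp add: eigvec_def wave_vec_def k_def del: of_nat_diff)
  next
    case 3
    \<comment> \<open>For even \<open>t\<close> this is \<open>2 * k = t\<close>, so the sine is
      taken strictly between 0 and \<open>pi\<close>.\<close>
    have "2 * k < n - 1" "0 < k" using 3 t by (auto simp: k_def)
    then have k: "0 < real (n - 1)" "2 * real k < real (n - 1)" "0 < real k" by linarith+
    then have "pi * (2 * real k) < pi * real (n - 1)" by (simp del: of_nat_diff)
    then have "0 < sin (2 * pi * real k / real (n - 1))"
      using k by (intro sin_gt_zero) (simp_all add: field_simps del: of_nat_diff)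
    then have "cos (2 * pi * real k * (real 1 + 0) / real (n - 1) - pi / 2) \<noteq> 0"
      by (simp add: cos_diff del: of_nat_diff)
    moreover have "eigvec n t = wave_vec n k (pi / 2)" using 3 by (simp add: eigvec_def k_def)
    moreover have "wave_vec n k (pi / 2) $ Suc 1 =
        rim_amp n k * cos (2 * pi * real k * (real 1 + 0) / real (n - 1) - pi / 2)"
      unfolding wave_vec_def using n by (intro block_vec_index) simp
    ultimately show ?thesis using n rim
      by (intro exI[of _ "Suc 1"]) (simp del: of_nat_diff)
  qed
  then obtain i where i: "i < 2 * n - 1" "eigvec n t $ i \<noteq> 0" by auto
  then have "0 < (\<Sum>i<2 * n - 1. eigvec n t $ i * eigvec n t $ i)"
    by (intro sum_pos2[of _ i]) (auto simp: zero_less_mult_iff linorder_neq_iff)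
  then show ?thesis using n by (simp add: scalar_prod_def dim_eigvec atLeast0LessThan)
qed

section \<open>The entries of the summands as rank-one terms\<close>

lemma A_mat_index:
  assumes n: "3 \<le> n" and "a < 2 * n - 1" "b < 2 * n - 1"
  shows "A_mat n $$ (a, b) = eigval n 0 * eigvec n 0 $ a * eigvec n 0 $ b"
proof -
  define p where "p = n - 1"
  have pS: "n - Suc 0 = p" by (simp add: p_def)
  have ab: "a < 2 * p + 1" "b < 2 * p + 1" and p: "0 < p" using assms by (auto simp: p_def)
  define u where "u = (real n - 2) / (3 * (real n - 1))"
  define v where "v = - (real n + 1) / (3 * (real n - 1))"
  \<comment> \<open>The coefficients of the \<open>J_mat\<close> blocks are the products of the two
    block values of \<open>eigvec n 0\<close>, which makes the matrix an outer product.\<close>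
  have uu: "(real n - 2)\<^sup>2 / (9 * (real n - 1)\<^sup>2) = u * u"
    and uv: "- (real n - 2) * (real n + 1) / (9 * (real n - 1)\<^sup>2) = u * v"
    and vv: "(real n + 1)\<^sup>2 / (9 * (real n - 1)\<^sup>2) = v * v"
    by (simp_all only: u_def v_def times_divide_times_eq power2_eq_square)
  have A: "A_mat n = (9 * (real n - 1) / (real n + 4)\<^sup>2) \<cdot>\<^sub>m
     nine_block_mat (1\<^sub>m 1) (u \<cdot>\<^sub>m transpose_mat (ones_col p)) (v \<cdot>\<^sub>m transpose_mat (ones_col p))
       (u \<cdot>\<^sub>m ones_col p) ((u * u) \<cdot>\<^sub>m J_mat p) ((u * v) \<cdot>\<^sub>m J_mat p)
       (v \<cdot>\<^sub>m ones_col p) ((u * v) \<cdot>\<^sub>m J_mat p) ((v * v) \<cdot>\<^sub>m J_mat p)"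
    unfolding A_mat_def Let_def p_def uu uv vv unfolding u_def v_def ..
  have vec: "eigvec n 0 = block_vec p 1 (\<lambda>_. u) (\<lambda>_. v)"
    by (simp only: eigvec_def u_def v_def p_def refl if_True)
  have J: "J_mat p $$ (i, j) = 1" if "i < p" "j < p" for i j
    using that by (simp add: J_mat_def ones_col_def scalar_prod_def)
  have dims: "J_mat p \<in> carrier_mat p p" "ones_col p \<in> carrier_mat p (Suc 0)"
    by (auto simp: J_mat_def ones_col_def)
  note [simp] = J nine_block_mat_index[where p = p] dims
  have [simp]: "dim_row (J_mat p) = p" "dim_col (J_mat p) = p"
    "dim_row (ones_col p) = p" "dim_col (ones_col p) = 1"
    "\<And>i. i < p \<Longrightarrow> ones_col p $$ (i, 0) = 1"
    by (simp_all add: dims[THEN carrier_matD(1)] dims[THEN carrier_matD(2)]) (simp add: ones_col_def)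
  note e = A vec eigval_def
  from ab(1) show ?thesis
  proof (cases rule: index_block_cases)
    case 1
    from ab(2) show ?thesis
      by (cases rule: index_block_cases) (use 1 p in \<open>simp_all add: e\<close>)
  next
    case (2 i)
    from ab(2) show ?thesis
      by (cases rule: index_block_cases) (use 2 p in \<open>simp_all add: e\<close>)
  next
    case (3 i)
    from ab(2) show ?thesis
      by (cases rule: index_block_cases) (use 3 p in \<open>simp_all add: e\<close>)
  qed
qed

text \<open>The leading 1 of the first row is the cosine at position 0, so one formula covers the
  whole row; periodicity then disposes of the \<open>mod\<close>.\<close>

lemma C_mat_index:
  assumes "2 \<le> n" "i < n - 1" "j < n - 1"
  shows "C_mat n k $$ (i, j) = cos (2 * pi * real k * (real j - real i) / real (n - 1))"
proof -
  define p where "p = n - 1"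
  have pS: "n - Suc 0 = p" by (simp add: p_def)
  have p: "0 < p" "real n - 1 = real p" using assms by (auto simp: p_def)
  have len: "length (1 # cos_list n k) = p" using assms by (simp add: cos_list_def p_def)
  have nth: "(1 # cos_list n k) ! l = cos (2 * pi * real l * real k / real p)" if "l < p" for l
  proof (cases l)
    case (Suc r)
    then have "[Suc 0..<p] ! r = Suc r" using that nth_upt[of "Suc 0" r p] by simp
    then show ?thesis using Suc that by (simp add: cos_list_def p pS)
  qed simp
  have "C_mat n k = mat p p (\<lambda>(i, j). (1 # cos_list n k) ! ((j + p - i) mod p))"
    unfolding C_mat_def Circ_def Let_def len ..
  then have "C_mat n k $$ (i, j) = cos (2 * pi * real ((j + p - i) mod p) * real k / real p)"
    using assms(2,3) p by (simp add: nth pS)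
  also have "\<dots> = cos (2 * pi * real (j + p - i) * real k / real p)"
    using cos_mod_period[OF p(1), of _ _ 0] by simp
  \<comment> \<open>The subtraction is not truncated, as \<open>i < p\<close>, and the summand
    \<open>p\<close> contributes \<open>k\<close> full turns.\<close>
  also have "2 * pi * real (j + p - i) * real k / real p =
      2 * pi * real k * (real j - real i) / real p + (2 * pi) * real_of_int (int k)"
    using assms(2) p(1) by (simp add: pS of_nat_diff field_simps)
  also have "cos \<dots> = cos (2 * pi * real k * (real j - real i) / real p)"
    by (simp only: cos_add cos_int_2pin sin_int_2pin)
  finally show ?thesis by (simp add: p_def)
qed

text \<open>Here the first row starts at the cosine of position 1, which explains the summand 1; its
  final 1 is the cosine at position \<open>p\<close>, a whole number of turns.\<close>

lemma Ct_mat_index: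
  assumes "2 \<le> n" "i < n - 1" "j < n - 1"
  shows "Ct_mat n k $$ (i, j) = cos (2 * pi * real k * (real j - real i + 1) / real (n - 1))"
proof -
  define p where "p = n - 1"
  have pS: "n - Suc 0 = p" by (simp add: p_def)
  have p: "0 < p" "real n - 1 = real p" using assms by (auto simp: p_def)
  have len: "length (cos_list n k @ [1]) = p" using assms by (simp add: cos_list_def p_def)
  have nth: "(cos_list n k @ [1]) ! l = cos (2 * pi * real (l + 1) * real k / real p)" if "l < p" for l
  proof (cases "l = p - 1")
    case True
    have "real l + 1 = real p" using True p by simp
    then have "2 * pi * real (l + 1) * real k / real p = (2 * pi) * real_of_int (int k)"
      using p by (simp add: add.commute)
    moreover have "(cos_list n k @ [1]) ! l = 1"
      using True by (simp add: nth_append cos_list_def p_def)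
    ultimately show ?thesis by (simp only: cos_int_2pin)
  next
    case False
    then have "l < p - Suc 0" using that by simp
    then show ?thesis by (simp add: nth_append cos_list_def p pS add.commute)
  qed
  have "Ct_mat n k $$ (i, j) = cos (2 * pi * real ((j + p - i) mod p + 1) * real k / real p)"
    using assms(2,3) p by (simp add: Ct_mat_def Circ_def Let_def len nth add: pS del: length_append)
  also have "2 * pi * real ((j + p - i) mod p + 1) * real k / real p =
     2 * pi * real ((j + p - i) mod p) * real k / real p + 2 * pi * real k / real p"
    by (simp add: algebra_simps add_divide_distrib)
  also have "cos \<dots> = cos (2 * pi * real (j + p - i) * real k / real p + 2 * pi * real k / real p)"
    by (rule cos_mod_period[OF p(1)])
  also have "2 * pi * real (j + p - i) * real k / real p + 2 * pi * real k / real p =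
      2 * pi * real k * (real j - real i + 1) / real p + (2 * pi) * real_of_int (int k)"
    using assms(2) p(1) by (simp add: pS of_nat_diff field_simps)
  also have "cos \<dots> = cos (2 * pi * real k * (real j - real i + 1) / real p)"
    by (simp only: cos_add cos_int_2pin sin_int_2pin)
  finally show ?thesis by (simp add: p_def)
qed

text \<open>In every nonzero block the entry is a multiple of the cosine of a difference of two
  sample angles, and \<open>cos_diff\<close> splits it into the cosine and the sine term. In the
  mixed blocks, \<open>double\<close> supplies the half-integer offset and a factor
  \<open>2 * f\<close>, which turns \<open>1 / (4 * f\<^sup>2)\<close> into
  \<open>1 / (2 * f)\<close>, the product of the two amplitudes.\<close>

lemma B_mat_index:
  assumes n: "3 \<le> n" and k: "0 < k" "2 * k < n - 1" and "a < 2 * n - 1" "b < 2 * n - 1"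
  shows "B_mat n k $$ (a, b) = eigval n (2 * k - 1) * eigvec n (2 * k - 1) $ a * eigvec n (2 * k - 1) $ b
     + eigval n (2 * k) * eigvec n (2 * k) $ a * eigvec n (2 * k) $ b"
proof -
  define p where "p = n - 1"
  have pS: "n - Suc 0 = p" by (simp add: p_def)
  define f where "f = phi n k"
  define \<theta> where "\<theta> = 2 * pi * real k / real p"
  define c where "c = 2 / ((real n - 1) * (2 * f + 1 / (2 * f))\<^sup>2)"
  have ab: "a < 2 * p + 1" "b < 2 * p + 1" and p: "0 < p" using assms by (auto simp: p_def)
  have pn: "real n - 1 = real p" using n by (auto simp: p_def)
  have f0: "f \<noteq> 0" using phi_pos[OF k(2)] by (simp add: f_def)
  have f: "f = cos (\<theta> / 2)" by (simp add: f_def phi_def pn \<theta>_def)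
  have C: "C_mat n k $$ (i, j) = cos (\<theta> * (real j - real i))" if "i < p" "j < p" for i j
    using C_mat_index[of n i j k] that n by (simp add: p_def \<theta>_def)
  have Ct: "Ct_mat n k $$ (i, j) = cos (\<theta> * (real j - real i + 1))" if "i < p" "j < p" for i j
    using Ct_mat_index[of n i j k] that n by (simp add: p_def \<theta>_def)
  have double: "cos (\<theta> * x) + cos (\<theta> * (x + 1)) = 2 * f * cos (\<theta> * (x + 1 / 2))" for x
  proof -
    have "cos (\<theta> * x) = cos (\<theta> * (x + 1 / 2) - \<theta> / 2)"
      "cos (\<theta> * (x + 1)) = cos (\<theta> * (x + 1 / 2) + \<theta> / 2)"
      by (simp_all add: algebra_simps)
    then show ?thesis by (simp only: f cos_add cos_diff) simp
  qed
  have dims: "C_mat n k \<in> carrier_mat p p" "Ct_mat n k \<in> carrier_mat p p"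
    "transpose_mat (Ct_mat n k) \<in> carrier_mat p p"
    using n by (auto simp: C_mat_def Ct_mat_def Circ_def Let_def cos_list_def p_def)
  have odd: "eigvec n (2 * k - 1) = block_vec p 0 (\<lambda>i. cos (\<theta> * real i) / (2 * f))
       (\<lambda>i. cos (\<theta> * (real i + 1 / 2)))"
    and even: "eigvec n (2 * k) = block_vec p 0 (\<lambda>i. sin (\<theta> * real i) / (2 * f))
       (\<lambda>i. sin (\<theta> * (real i + 1 / 2)))"
    using k by (simp_all add: eigvec_def wave_vec_def rim_amp_def pendant_amp_def pS
       \<theta>_def f_def cos_diff)
  \<comment> \<open>The simplifier turns the index into \<open>2 * k - Suc 0\<close>, so the rewrite
    rule must have that form.\<close>
  note odd = odd[unfolded One_nat_def]
  have val: "eigval n (2 * k - 1) = c" "eigval n (2 * k) = c"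
    using k by (simp_all add: eigval_def Let_def c_def f_def)
  note [simp] = nine_block_mat_index[where p = p] dims
  have [simp]: "dim_row (C_mat n k) = p" "dim_col (C_mat n k) = p"
     "dim_row (Ct_mat n k) = p" "dim_col (Ct_mat n k) = p"
    by (simp_all add: dims[THEN carrier_matD(1)] dims[THEN carrier_matD(2)])
  define N where "N = nine_block_mat
       (0\<^sub>m 1 1) (0\<^sub>m 1 p) (0\<^sub>m 1 p)
       (0\<^sub>m p 1) ((1 / (4 * f\<^sup>2)) \<cdot>\<^sub>m C_mat n k) ((1 / (4 * f\<^sup>2)) \<cdot>\<^sub>m (C_mat n k + Ct_mat n k))
       (0\<^sub>m p 1) ((1 / (4 * f\<^sup>2)) \<cdot>\<^sub>m (C_mat n k + transpose_mat (Ct_mat n k))) (C_mat n k)"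
  have B: "B_mat n k $$ (a, b) = c * N $$ (a, b)"
    using ab by (simp add: B_mat_def Let_def N_def c_def f_def pS)
  have "N $$ (a, b) = eigvec n (2 * k - 1) $ a * eigvec n (2 * k - 1) $ b
     + eigvec n (2 * k) $ a * eigvec n (2 * k) $ b"
    using ab(1)
  proof (cases rule: index_block_cases)
    case 1
    from ab(2) show ?thesis
      by (cases rule: index_block_cases) (use 1 p in \<open>simp_all add: odd even N_def\<close>)
  next
    case (2 i)
    from ab(2) show ?thesis
    proof (cases rule: index_block_cases)
      case 1
      then show ?thesis using 2 p by (simp add: odd even N_def)
    next
      case (2 j)
      have "cos (\<theta> * (real j - real i)) =
          cos (\<theta> * real i) * cos (\<theta> * real j) + sin (\<theta> * real i) * sin (\<theta> * real j)"
        by (simp add: right_diff_distrib cos_diff)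
      then show ?thesis using \<open>i < p\<close> \<open>a = Suc i\<close> 2 f0
        by (simp add: odd even N_def C add_divide_distrib power2_eq_square)
    next
      case (3 j)
      have "cos (\<theta> * (real j - real i)) + cos (\<theta> * (real j - real i + 1)) =
          2 * f * cos (\<theta> * (real j + 1 / 2) - \<theta> * real i)"
        unfolding double by (simp add: algebra_simps)
      also have "\<dots> = 2 * f * (cos (\<theta> * real i) * cos (\<theta> * (real j + 1 / 2)) +
          sin (\<theta> * real i) * sin (\<theta> * (real j + 1 / 2)))"
        by (simp only: cos_diff) simp
      finally have "N $$ (a, b) = 1 / (4 * f\<^sup>2) * \<dots>"
        using \<open>i < p\<close> \<open>a = Suc i\<close> 3 by (simp add: N_def C Ct)
      then show ?thesis using \<open>i < p\<close> \<open>a = Suc i\<close> 3 f0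
        by (simp add: odd even power2_eq_square add_divide_distrib distrib_left)
    qed
  next
    case (3 i)
    from ab(2) show ?thesis
    proof (cases rule: index_block_cases)
      case 1
      then show ?thesis using 3 p by (simp add: odd even N_def)
    next
      case (2 j)
      \<comment> \<open>The transpose of \<open>Ct_mat\<close> brings in \<open>i - j\<close>; as
        cosine is even, \<open>C_mat\<close> can be read with the same difference, and
        \<open>double\<close> applies.\<close>
      have "cos (\<theta> * (real j - real i)) = cos (\<theta> * (real i - real j))"
        by (metis cos_minus minus_diff_eq mult_minus_right)
      then have "cos (\<theta> * (real j - real i)) + cos (\<theta> * (real i - real j + 1)) =
          2 * f * cos (\<theta> * (real i + 1 / 2) - \<theta> * real j)"
        using double[of "real i - real j"] by (simp add: algebra_simps)
      also have "\<dots> = 2 * f * (cos (\<theta> * (real i + 1 / 2)) * cos (\<theta> * real j) +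
          sin (\<theta> * (real i + 1 / 2)) * sin (\<theta> * real j))"
        by (simp only: cos_diff)
      finally have "N $$ (a, b) = 1 / (4 * f\<^sup>2) * \<dots>"
        using \<open>i < p\<close> \<open>a = Suc (p + i)\<close> 2 by (simp add: N_def C Ct)
      then show ?thesis using \<open>i < p\<close> \<open>a = Suc (p + i)\<close> 2 f0
        by (simp add: odd even power2_eq_square add_divide_distrib distrib_left
            mult.commute[of "cos (\<theta> * real j)"] mult.commute[of "sin (\<theta> * real j)"])
    next
      case (3 j)
      have "\<theta> * (real j - real i) = \<theta> * (real j + 1 / 2) - \<theta> * (real i + 1 / 2)"
        by (simp add: algebra_simps)
      then have "cos (\<theta> * (real j - real i)) =
          cos (\<theta> * (real i + 1 / 2)) * cos (\<theta> * (real j + 1 / 2)) +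
          sin (\<theta> * (real i + 1 / 2)) * sin (\<theta> * (real j + 1 / 2))"
        by (simp only: cos_diff) simp
      then show ?thesis using \<open>i < p\<close> \<open>a = Suc (p + i)\<close> 3
        by (simp add: odd even N_def C)
    qed
  qed
  then show ?thesis unfolding B val by (simp add: distrib_left mult.assoc)
qed

text \<open>For odd \<open>n\<close> the last index \<open>n - 2\<close> is an unpaired cosine of
  frequency \<open>(n - 1) / 2\<close>. At the integers it takes the values
  \<open>(- 1) ^ i\<close>, while the sine of that frequency vanishes there.\<close>

lemma H_mat_index:
  assumes n: "3 \<le> n" "odd n" and "a < 2 * n - 1" "b < 2 * n - 1"
  shows "H_mat n $$ (a, b) = eigval n (n - 2) * eigvec n (n - 2) $ a * eigvec n (n - 2) $ b"
proof -
  define p where "p = n - 1"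
  have pS: "n - Suc 0 = p" by (simp add: p_def)
  have ab: "a < 2 * p + 1" "b < 2 * p + 1" and p: "0 < p" using assms by (auto simp: p_def)
  have half: "2 * ((n - 2 + 1) div 2) = p" using n by (auto simp: p_def elim!: oddE)
  define k where "k = (n - 2 + 1) div 2"
  have k: "2 * k = p" using half by (simp add: k_def)
  then have "real p = 2 * real k" by simp
  then have arg: "2 * pi * real k * real i / real p = real i * pi" for i
    using p by simp
  have "eigvec n (n - 2) = wave_vec n k 0" using n by (simp add: eigvec_def k_def)
  then have vec: "eigvec n (n - 2) = block_vec p 0 (\<lambda>i. (- 1) ^ i) (\<lambda>_. 0)"
    by (simp add: wave_vec_def rim_amp_def pendant_amp_def pS k arg)
  have val: "eigval n (n - 2) = 1 / (real n - 1)"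
    using n half by (simp add: eigval_def Let_def pS)
  have R: "R_mat p \<in> carrier_mat p p" by (simp add: R_mat_def)
  have [simp]: "dim_row (R_mat p) = p" "dim_col (R_mat p) = p"
    "\<And>i j. i < p \<Longrightarrow> j < p \<Longrightarrow> R_mat p $$ (i, j) = (- 1) ^ i * (- 1) ^ j"
    by (simp_all add: R_mat_def power_add)
  note [simp] = nine_block_mat_index[where p = p] R
  note e = vec val H_mat_def Let_def pS
  from ab(1) show ?thesis
  proof (cases rule: index_block_cases)
    case 1
    from ab(2) show ?thesis
      by (cases rule: index_block_cases) (use 1 p in \<open>simp_all add: e\<close>)
  next
    case (2 i)
    from ab(2) show ?thesis
      by (cases rule: index_block_cases) (use 2 p in \<open>simp_all add: e\<close>)
  next
    case (3 i)
    from ab(2) show ?thesis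
      by (cases rule: index_block_cases) (use 3 p in \<open>simp_all add: e\<close>)
  qed
qed

section \<open>Assembling the matrices and the theorem\<close>

text \<open>Groups the indices after 0 into the cosine-sine pairs that make up the matrices
  \<open>B_mat n k\<close>.\<close>

lemma sum_lessThan_odd_pairs:
  fixes F :: "nat \<Rightarrow> 'a :: comm_monoid_add"
  shows "(\<Sum>t<2 * K + 1. F t) = F 0 + (\<Sum>k = 1..K. F (2 * k - 1) + F (2 * k))"
  by (induction K) (simp_all add: add.assoc)

lemma A_mat_plus_B_sum_index:
  assumes "3 \<le> n" "2 * K < n - 1" "a < 2 * n - 1" "b < 2 * n - 1"
  shows "A_mat n $$ (a, b) + B_sum n K $$ (a, b) =
     (\<Sum>t<2 * K + 1. eigval n t * eigvec n t $ a * eigvec n t $ b)"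
  unfolding sum_lessThan_odd_pairs using assms
  by (simp add: B_sum_def A_mat_index B_mat_index)

text \<open>Index 0 and the pairs use up all \<open>n - 1\<close> indices.\<close>

lemma L_even_eq:
  assumes "even n" "4 \<le> n"
  shows "L_even n = rank_one_sum (2 * n - 1) (n - 1) (eigval n) (eigvec n)"
proof -
  have K: "2 * ((n - 2) div 2) + 1 = n - 1" using assms by (auto elim!: evenE)
  show ?thesis
    using assms carrier_L(1)[of n] A_mat_plus_B_sum_index[of n "(n - 2) div 2"] unfolding K
    by (intro eq_matI) (auto simp: L_even_def rank_one_sum_def B_sum_def[of n "(n - 2) div 2"])
qed

text \<open>The pairs stop at index \<open>n - 3\<close>; the remaining index \<open>n - 2\<close>
  is the one of \<open>H_mat n\<close>.\<close>

lemma L_odd_eq: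
  assumes "odd n" "5 \<le> n"
  shows "L_odd n = rank_one_sum (2 * n - 1) (n - 1) (eigval n) (eigvec n)"
proof (rule eq_matI)
  let ?K = "(n - 3) div 2"
  have K: "2 * ?K + 1 = n - 2" using assms by (auto elim!: oddE)
  have dims: "dim_row (A_mat n) = 2 * n - 1" "dim_col (A_mat n) = 2 * n - 1"
    "dim_row (H_mat n) = 2 * n - 1" "dim_col (H_mat n) = 2 * n - 1"
    "dim_row (B_sum n ?K) = 2 * n - 1" "dim_col (B_sum n ?K) = 2 * n - 1"
    using carrier_L(1,3)[of n] assms by (auto simp: B_sum_def)
  fix a b
  assume "a < dim_row (rank_one_sum (2 * n - 1) (n - 1) (eigval n) (eigvec n))"
    "b < dim_col (rank_one_sum (2 * n - 1) (n - 1) (eigval n) (eigvec n))"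
  then have ab: "a < 2 * n - 1" "b < 2 * n - 1" by (simp_all add: rank_one_sum_def)
  have B: "A_mat n $$ (a, b) + B_sum n ?K $$ (a, b) =
      (\<Sum>t<n - 2. eigval n t * eigvec n t $ a * eigvec n t $ b)"
    by (rule A_mat_plus_B_sum_index[of n ?K a b, unfolded K]) (use ab assms K in linarith)+
  have H: "H_mat n $$ (a, b) = eigval n (n - 2) * eigvec n (n - 2) $ a * eigvec n (n - 2) $ b"
    using H_mat_index ab assms by simp
  have "L_odd n $$ (a, b) = (A_mat n $$ (a, b) + B_sum n ?K $$ (a, b)) + H_mat n $$ (a, b)"
    using ab by (simp add: L_odd_def dims)
  also have "\<dots> = (\<Sum>t<Suc (n - 2). eigval n t * eigvec n t $ a * eigvec n t $ b)"
    using B H by (simp only: sum.lessThan_Suc)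
  also have "Suc (n - 2) = n - 1" using assms by simp
  finally show "L_odd n $$ (a, b) =
      rank_one_sum (2 * n - 1) (n - 1) (eigval n) (eigvec n) $$ (a, b)"
    using ab by (simp add: rank_one_sum_def)
qed (use carrier_L(5)[of n] assms in \<open>auto simp: rank_one_sum_def\<close>)

text \<open>Both parities lead to this same expression, so the three properties are proved once for
  both.\<close>

lemma rank_one_sum_eigvec:
  assumes n: "3 \<le> n"
  defines "M \<equiv> rank_one_sum (2 * n - 1) (n - 1) (eigval n) (eigvec n)"
  shows "positive_semidefinite M" "\<forall>i < 2 * n - 1. row_sum M i = 0"
    "vec_space.rank (2 * n - 1) M = n - 1"
proof -
  have w: "eigvec n t \<in> carrier_vec (2 * n - 1)" for t
    using n by (intro carrier_vecI dim_eigvec) simp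
  have c: "0 < eigval n t" for t using eigval_pos n by simp
  show "positive_semidefinite M" unfolding M_def
    by (rule positive_semidefinite_rank_one_sum[OF less_imp_le[OF c]])
  show "\<forall>i < 2 * n - 1. row_sum M i = 0" unfolding M_def
    using sum_eigvec n by (simp add: row_sum_rank_one_sum)
  interpret vec_space "TYPE(real)" "2 * n - 1" .
  show "rank M = n - 1" unfolding M_def
    using n c by (intro rank_orthogonal_rank_one_sum w eigvec_orthogonal eigvec_nonzero)
      (simp_all add: less_imp_neq[symmetric])
qed

theorem theorem9:
  fixes n :: nat
  shows "(even n \<and> 4 \<le> n \<longrightarrow>
            positive_semidefinite (L_even n) \<and>
            (\<forall>i < 2 * n - 1. row_sum (L_even n) i = 0) \<and>
            vec_space.rank (2 * n - 1) (L_even n) = n - 1) \<and>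
         (odd n \<and> 5 \<le> n \<longrightarrow>
            positive_semidefinite (L_odd n) \<and>
            (\<forall>i < 2 * n - 1. row_sum (L_odd n) i = 0) \<and>
            vec_space.rank (2 * n - 1) (L_odd n) = n - 1)"
  using rank_one_sum_eigvec[of n] by (auto simp: L_even_eq L_odd_eq)

end
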